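(* Let $I\subset\mathbb{R}$ be an interval with interior $I^{o}$, let $f:I^{o}\to\mathbb{R}$ be differentiable on $I^{o}$, let $a,b\in I^{o}$ with $a<b$, and let $q\ge 1$ be a real number. If $|f'|^{q}$ is quasi-convex on $[a,b]$, then for every $x\in[a,b]$ the following inequality holds: $$\left|\frac{(b-x)f(b)+(x-a)f(a)}{b-a}-\frac{1}{b-a}\int_{a}^{b}f(u)\,du\right|\le \frac{(x-a)^{2}}{2(b-a)}\left(\max\{|f'(x)|^{q},|f'(a)|^{q}\}\right)^{\frac1q}+\frac{(b-x)^{2}}{2(b-a)}\left(\max\{|f'(x)|^{q},|f'(b)|^{q}\}\right)^{\frac1q}.$$
   Context: A function $g:[a,b]\to\mathbb{R}$ is called quasi-convex on $[a,b]$ if $g(\lambda u+(1-\lambda)v)\le\max\{g(u),g(v)\}$ for all $u,v\in[a,b]$ and all $\lambda\in[0,1]$. *)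

theory Defs
  imports "HOL-Analysis.Analysis"
begin

definition quasi_convex_on :: "real set \<Rightarrow> (real \<Rightarrow> real) \<Rightarrow> bool" where
  "quasi_convex_on S g \<longleftrightarrow>
     (\<forall>u\<in>S. \<forall>v\<in>S. \<forall>t\<in>{0..1}. g (t * u + (1 - t) * v) \<le> max (g u) (g v))"

end

theory Submission
  imports Defs
begin

text \<open>
  The left-hand side is the sum of the integrals of \<open>f a - f u\<close> over \<open>[a, x]\<close> and of \<open>f b - f u\<close>
  over \<open>[x, b]\<close>, divided by \<open>b - a\<close>. By quasi-convexity \<open>\<bar>f'\<bar>\<close> is bounded on each of the two
  intervals by its larger endpoint value, so the mean value theorem bounds the integrands by a constant times
  \<open>u - a\<close> and \<open>b - u\<close> respectively.
\<close>

lemma quasi_convex_on_le_max_endpoints: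
  assumes "quasi_convex_on S g" and "y \<in> S" "z \<in> S" and "u \<in> {y..z}"
  shows "g u \<le> max (g y) (g z)"
proof -
  \<comment> \<open>The segment is taken from \<open>z\<close> to \<open>y\<close> so that the
    parameter \<open>t\<close> weights \<open>y\<close>, matching the convex combination in
    \<open>quasi_convex_on_def\<close>.\<close>
  have "u \<in> closed_segment z y"
    using assms(4) by (simp add: closed_segment_eq_real_ivl)
  then obtain t where "t \<in> {0..1}" "u = t * y + (1 - t) * z"
    by (auto simp: closed_segment_def)
  then show ?thesis
    using assms(1-3) unfolding quasi_convex_on_def by blast
qed

text \<open>The integral of \<open>\<bar>p - u\<bar>\<close> over \<open>{c..d}\<close> is half the
  squared length for either endpoint \<open>p\<close>. Both choices are allowed because the left
  endpoint is needed on \<open>{a..x}\<close> and the right one on \<open>{x..b}\<close>.\<close>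

lemma rectangle_rule_endpoint_bound:
  fixes f :: "real \<Rightarrow> real"
  assumes "c \<le> d" and "p = c \<or> p = d"
    and deriv: "\<And>u. u \<in> {c..d} \<Longrightarrow> (f has_real_derivative f' u) (at u)"
    and bound: "\<And>u. u \<in> {c..d} \<Longrightarrow> \<bar>f' u\<bar> \<le> M"
  shows "\<bar>(d - c) * f p - integral {c..d} f\<bar> \<le> (d - c)\<^sup>2 / 2 * M"
proof -
  have "p \<in> {c..d}"
    using assms(1,2) by auto
  have lipschitz: "\<bar>f p - f u\<bar> \<le> M * \<bar>p - u\<bar>" if "u \<in> {c..d}" for u
    using field_differentiable_bound[of "{c..d}" f f' M p u] deriv bound that \<open>p \<in> {c..d}\<close>
    by (auto intro: has_field_derivative_at_within)
  have "f integrable_on {c..d}"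
    by (meson DERIV_isCont continuous_at_imp_continuous_on deriv integrable_continuous_interval)
  then have err: "((\<lambda>u. f p - f u) has_integral ((d - c) * f p - integral {c..d} f)) {c..d}"
    using has_integral_diff[OF has_integral_const_real[of "f p" c d] integrable_integral] \<open>c \<le> d\<close>
    by simp
  \<comment> \<open>As \<open>p\<close> is an endpoint, \<open>u - p\<close> keeps one sign on the
    interval. Recording it in \<open>s\<close> makes the majorant linear in \<open>u\<close>, with
    antiderivative \<open>M * s * (u - p)\<^sup>2 / 2\<close> for both cases.\<close>
  define s :: real where "s = (if p = c then 1 else -1)"
  have s: "\<bar>p - u\<bar> = s * (u - p)" if "u \<in> {c..d}" for u
    using that assms(1,2) by (auto simp: s_def)
  have "((\<lambda>u. M * (s * (u - p))) has_integral
      (M * s * (d - p)\<^sup>2 / 2 - M * s * (c - p)\<^sup>2 / 2)) {c..d}"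
    by (rule fundamental_theorem_of_calculus[OF \<open>c \<le> d\<close>])
      (auto simp flip: has_real_derivative_iff_has_vector_derivative intro!: derivative_eq_intros)
  \<comment> \<open>The boundary term at \<open>p\<close> vanishes; in the other one
    \<open>s\<close> cancels the sign from its position as upper or lower limit.\<close>
  moreover have "M * s * (d - p)\<^sup>2 / 2 - M * s * (c - p)\<^sup>2 / 2 = (d - c)\<^sup>2 / 2 * M"
    using assms(1,2) by (auto simp: s_def power2_commute)
  ultimately have maj: "((\<lambda>u. M * (s * (u - p))) has_integral (d - c)\<^sup>2 / 2 * M) {c..d}"
    by simp
  have "norm (integral {c..d} (\<lambda>u. f p - f u)) \<le> integral {c..d} (\<lambda>u. M * (s * (u - p)))"
    using err maj lipschitz s by (intro integral_norm_bound_integral) auto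
  then show ?thesis
    unfolding integral_unique[OF err] integral_unique[OF maj] by simp
qed

theorem theorem8:
  fixes I :: "real set" and f :: "real \<Rightarrow> real" and a b q :: real
  assumes "is_interval I"
    and "f differentiable_on interior I"
    and "a \<in> interior I" and "b \<in> interior I" and "a < b"
    and "q \<ge> 1"
    and "quasi_convex_on {a..b} (\<lambda>u. \<bar>deriv f u\<bar> powr q)"
  shows "\<forall>x\<in>{a..b}.
    \<bar>((b - x) * f b + (x - a) * f a) / (b - a) - 1 / (b - a) * integral {a..b} f\<bar>
      \<le> (x - a)\<^sup>2 / (2 * (b - a)) * (max (\<bar>deriv f x\<bar> powr q) (\<bar>deriv f a\<bar> powr q)) powr (1 / q)
        + (b - x)\<^sup>2 / (2 * (b - a)) * (max (\<bar>deriv f x\<bar> powr q) (\<bar>deriv f b\<bar> powr q)) powr (1 / q)"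
proof
  fix x
  assume "x \<in> {a..b}"
  then have x: "a \<le> x" "x \<le> b" by auto
  have "is_interval (interior I)"
    using assms(1) by (simp add: is_interval_convex_1)
  \<comment> \<open>Since the interior is open and contains \<open>{a..b}\<close>, the derivatives
    are two-sided even at \<open>a\<close> and \<open>b\<close>.\<close>
  then have "{a..b} \<subseteq> interior I"
    using mem_is_interval_1_I[OF _ assms(3,4)] by auto
  then have deriv: "(f has_real_derivative deriv f u) (at u)" if "u \<in> {a..b}" for u
    using that assms(2)
    by (auto simp: DERIV_deriv_iff_real_differentiable differentiable_on_eq_differentiable_at)
  have rectangle: "\<bar>(d - c) * f p - integral {c..d} f\<bar>
      \<le> (d - c)\<^sup>2 / 2 * (max (\<bar>deriv f c\<bar> powr q) (\<bar>deriv f d\<bar> powr q)) powr (1 / q)"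
    if "a \<le> c" "c \<le> d" "d \<le> b" "p = c \<or> p = d" for c d p
  proof (rule rectangle_rule_endpoint_bound[where f' = "deriv f"])
    fix u assume u: "u \<in> {c..d}"
    \<comment> \<open>Quasi-convexity controls only the \<open>q\<close>-th power of
      \<open>\<bar>deriv f u\<bar>\<close>; the monotone map \<open>powr (1 / q)\<close> turns this
      into a bound on \<open>\<bar>deriv f u\<bar>\<close> itself.\<close>
    have "\<bar>deriv f u\<bar> = (\<bar>deriv f u\<bar> powr q) powr (1 / q)"
      using assms(6) by (simp add: powr_powr)
    also have "\<dots> \<le> (max (\<bar>deriv f c\<bar> powr q) (\<bar>deriv f d\<bar> powr q)) powr (1 / q)"
      using quasi_convex_on_le_max_endpoints[OF assms(7), of c d u] u that assms(6)
      by (intro powr_mono2) auto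
    finally show "\<bar>deriv f u\<bar> \<le> (max (\<bar>deriv f c\<bar> powr q) (\<bar>deriv f d\<bar> powr q)) powr (1 / q)" .
  qed (use that deriv in auto)
  let ?A = "(max (\<bar>deriv f x\<bar> powr q) (\<bar>deriv f a\<bar> powr q)) powr (1 / q)"
  let ?B = "(max (\<bar>deriv f x\<bar> powr q) (\<bar>deriv f b\<bar> powr q)) powr (1 / q)"
  have "f integrable_on {a..b}"
    by (meson DERIV_isCont continuous_at_imp_continuous_on deriv integrable_continuous_interval)
  then have "integral {a..b} f = integral {a..x} f + integral {x..b} f"
    using Henstock_Kurzweil_Integration.integral_combine[OF x] by metis
  moreover have "\<bar>(x - a) * f a - integral {a..x} f\<bar> \<le> (x - a)\<^sup>2 / 2 * ?A"
    using rectangle[of a x a] x by (simp add: max.commute)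
  moreover have "\<bar>(b - x) * f b - integral {x..b} f\<bar> \<le> (b - x)\<^sup>2 / 2 * ?B"
    using rectangle[of x b b] x by simp
  \<comment> \<open>The triangle inequality adds the errors of the two subintervals.\<close>
  ultimately have "\<bar>(b - x) * f b + (x - a) * f a - integral {a..b} f\<bar>
      \<le> (x - a)\<^sup>2 / 2 * ?A + (b - x)\<^sup>2 / 2 * ?B"
    by linarith
  then have "\<bar>(b - x) * f b + (x - a) * f a - integral {a..b} f\<bar> / (b - a)
      \<le> ((x - a)\<^sup>2 / 2 * ?A + (b - x)\<^sup>2 / 2 * ?B) / (b - a)"
    using assms(5) by (simp add: divide_right_mono)
  moreover have "\<bar>((b - x) * f b + (x - a) * f a) / (b - a) - 1 / (b - a) * integral {a..b} f\<bar>
      = \<bar>(b - x) * f b + (x - a) * f a - integral {a..b} f\<bar> / (b - a)"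
    using assms(5) by (simp add: diff_divide_distrib[symmetric])
  ultimately show "\<bar>((b - x) * f b + (x - a) * f a) / (b - a) - 1 / (b - a) * integral {a..b} f\<bar>
      \<le> (x - a)\<^sup>2 / (2 * (b - a)) * ?A + (b - x)\<^sup>2 / (2 * (b - a)) * ?B"
    by (simp only: add_divide_distrib times_divide_eq_left divide_divide_eq_left)
qed

end
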